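(* Define polynomials $\Lambda_k$ in $\lambda$ by $\Lambda_1=\lambda$, $\Lambda_2=\lambda^2-\frac14$, and $\Lambda_k=\lambda\Lambda_{k-1}-\frac14\Lambda_{k-2}$ for every $k\ge 3$. Then for every integer $n\ge 3$, the Randić characteristic polynomial of the cycle graph $C_n$ on $n$ vertices is $$RP(C_n,\lambda)=\lambda\Lambda_{n-1}-\tfrac12\Lambda_{n-2}-\left(\tfrac12\right)^{n-1}.$$
   Context: All graphs are finite and simple. For a graph $G$ with vertices $v_1,\dots,v_n$ of degrees $d_1,\dots,d_n$, the Randić matrix $R(G)$ is the $n\times n$ real symmetric matrix with $(i,j)$-entry $\frac{1}{\sqrt{d_id_j}}$ if $v_i$ and $v_j$ are adjacent, and $0$ otherwise. The Randić characteristic polynomial of $G$ is $RP(G,\lambda)=\det(\lambda I-R(G))$. *)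

theory Defs
  imports "Graph_Theory.Pair_Digraph" "Jordan_Normal_Form.Char_Poly"
begin

text \<open>Finite simple graphs are represented as in the locale \<^locale>\<open>pair_graph\<close>: finite,
  loop-free digraphs in which every edge is present as a pair of opposite arcs. The degree of a
  vertex is therefore its out-degree. The rows and columns of the Randic matrix are labelled by
  the vertices in increasing order; the characteristic polynomial does not depend on this choice.\<close>

definition randic_matrix :: "'a::linorder pair_pre_digraph \<Rightarrow> real mat" where
  "randic_matrix G =
    (let vs = sorted_list_of_set (pverts G); n = length vs in
      mat n n (\<lambda>(i, j).
        if (vs ! i, vs ! j) \<in> parcs G
        then 1 / sqrt (real (out_degree (with_proj G) (vs ! i)) *
                       real (out_degree (with_proj G) (vs ! j)))
        else 0))"

definition randic_char_poly :: "'a::linorder pair_pre_digraph \<Rightarrow> real poly" where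
  "randic_char_poly G = char_poly (randic_matrix G)"

definition cycle_graph :: "nat \<Rightarrow> nat pair_pre_digraph" where
  "cycle_graph n =
    \<lparr> pverts = {0..<n},
      parcs = {(i, j). i < n \<and> j < n \<and> (j = (i + 1) mod n \<or> i = (j + 1) mod n)} \<rparr>"

lemma pair_graph_cycle_graph:
  assumes "n \<ge> 3"
  shows "pair_graph (cycle_graph n)"
proof
  show "finite (pverts (cycle_graph n))" by (simp add: cycle_graph_def)
  have "parcs (cycle_graph n) \<subseteq> {0..<n} \<times> {0..<n}" by (auto simp: cycle_graph_def)
  then show "finite (parcs (cycle_graph n))" by (rule finite_subset) simp
  show "\<And>e. e \<in> parcs (cycle_graph n) \<Longrightarrow> fst e \<in> pverts (cycle_graph n)"
    "\<And>e. e \<in> parcs (cycle_graph n) \<Longrightarrow> snd e \<in> pverts (cycle_graph n)"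
    by (auto simp: cycle_graph_def)
  show "\<And>e. e \<in> parcs (cycle_graph n) \<Longrightarrow> fst e \<noteq> snd e"
    using assms by (auto simp: cycle_graph_def mod_Suc split: if_splits)
  show "symmetric (with_proj (cycle_graph n))"
    by (auto simp: symmetric_def sym_def arcs_ends_def arc_to_ends_def cycle_graph_def)
qed

text \<open>The polynomials are indexed from 1; the value at 0 is the one obtained by extending the
  recurrence backwards.\<close>

fun Lambda :: "nat \<Rightarrow> real poly" where
  "Lambda 0 = 1"
| "Lambda (Suc 0) = [:0, 1:]"
| "Lambda (Suc (Suc 0)) = [:0, 1:]^2 - [:1/4:]"
| "Lambda (Suc (Suc (Suc k))) = [:0, 1:] * Lambda (Suc (Suc k)) - [:1/4:] * Lambda (Suc k)"

end

theory Submission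
  imports Defs
begin

text \<open>Every vertex of the cycle has degree 2, so \<open>\<lambda>I - R(C\<^sub>n)\<close> has \<open>\<lambda>\<close> on the diagonal and \<open>-1/2\<close> at
  cyclically adjacent positions. Expanding along the first row and then along the first columns of
  the two minors that still contain a corner entry leaves only triangular matrices, which
  contribute the constant term, and tridiagonal ones, whose determinants obey the recurrence of
  the \<open>\<Lambda>\<^sub>k\<close>.\<close>

section \<open>Laplace expansion in terms of entry functions\<close>

text \<open>Each minor is again written as \<open>mat\<close> of an explicit entry function, the
  conditional skipping column \<open>j\<close>, so that it can be expanded further in the same
  way.\<close>

lemma det_expand_first_row:
  fixes f :: "nat \<times> nat \<Rightarrow> 'a::comm_ring_1"
  shows "det (mat (Suc n) (Suc n) f) =
    (\<Sum>j<Suc n. (-1) ^ j * f (0, j) *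
      det (mat n n (\<lambda>(i, k). f (Suc i, if k < j then k else Suc k))))"
proof -
  have "det (mat (Suc n) (Suc n) f) =
      (\<Sum>j<Suc n. mat (Suc n) (Suc n) f $$ (0, j) * cofactor (mat (Suc n) (Suc n) f) 0 j)"
    by (rule laplace_expansion_row) auto
  also have "\<dots> = (\<Sum>j<Suc n. (-1) ^ j * f (0, j) *
      det (mat n n (\<lambda>(i, k). f (Suc i, if k < j then k else Suc k))))"
  proof (rule sum.cong[OF refl])
    fix j assume "j \<in> {..<Suc n}"
    moreover have "mat_delete (mat (Suc n) (Suc n) f) 0 j =
        mat n n (\<lambda>(i, k). f (Suc i, if k < j then k else Suc k))"
      by (rule eq_matI) (auto simp: mat_delete_def)
    ultimately show "mat (Suc n) (Suc n) f $$ (0, j) * cofactor (mat (Suc n) (Suc n) f) 0 j =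
        (-1) ^ j * f (0, j) * det (mat n n (\<lambda>(i, k). f (Suc i, if k < j then k else Suc k)))"
      by (simp add: cofactor_def mult_ac)
  qed
  finally show ?thesis .
qed

lemma det_expand_first_column:
  fixes f :: "nat \<times> nat \<Rightarrow> 'a::comm_ring_1"
  shows "det (mat (Suc n) (Suc n) f) =
    (\<Sum>i<Suc n. (-1) ^ i * f (i, 0) *
      det (mat n n (\<lambda>(k, j). f (if k < i then k else Suc k, Suc j))))"
proof -
  have transp: "det (mat k k (\<lambda>(i, j). g (j, i))) = det (mat k k g)"
    for k and g :: "nat \<times> nat \<Rightarrow> 'a"
  proof -
    have "mat k k (\<lambda>(i, j). g (j, i)) = transpose_mat (mat k k g)"
      by (rule eq_matI) auto
    then show ?thesis by (simp add: det_transpose[of _ k])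
  qed
  have "det (mat (Suc n) (Suc n) f) = det (mat (Suc n) (Suc n) (\<lambda>(i, j). f (j, i)))"
    by (simp only: transp)
  also have "\<dots> = (\<Sum>i<Suc n. (-1) ^ i * f (i, 0) *
      det (mat n n (\<lambda>(j, k). f (if k < i then k else Suc k, Suc j))))"
    by (subst det_expand_first_row) simp
  also have "\<dots> = (\<Sum>i<Suc n. (-1) ^ i * f (i, 0) *
      det (mat n n (\<lambda>(k, j). f (if k < i then k else Suc k, Suc j))))"
    using transp[of n "\<lambda>(k, j). f (if k < i then k else Suc k, Suc j)" for i] by simp
  finally show ?thesis .
qed

text \<open>Meant for the minors of the cyclic matrix that omit row 0 and keep column 0: in their
  first column only the top and the bottom entry can be nonzero.\<close>

lemma det_expand_first_column_ends:
  fixes f :: "nat \<times> nat \<Rightarrow> 'a::comm_ring_1"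
  assumes "\<And>i. 0 < i \<Longrightarrow> i < Suc n \<Longrightarrow> f (i, 0) = 0"
  shows "det (mat (Suc (Suc n)) (Suc (Suc n)) f) =
    f (0, 0) * det (mat (Suc n) (Suc n) (\<lambda>(i, j). f (Suc i, Suc j))) +
    (-1) ^ Suc n * f (Suc n, 0) * det (mat (Suc n) (Suc n) (\<lambda>(i, j). f (i, Suc j)))"
proof -
  define g where "g i = (-1) ^ i * f (i, 0) *
    det (mat (Suc n) (Suc n) (\<lambda>(k, j). f (if k < i then k else Suc k, Suc j)))" for i
  have "det (mat (Suc (Suc n)) (Suc (Suc n)) f) = sum g {..<Suc (Suc n)}"
    unfolding g_def by (rule det_expand_first_column)
  also have "\<dots> = sum g {0, Suc n}"
    by (rule sum.mono_neutral_right) (auto simp: g_def assms)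
  also have "\<dots> = g 0 + g (Suc n)"
    by simp
  also have "mat (Suc n) (Suc n) (\<lambda>(k, j). f (if k < Suc n then k else Suc k, Suc j)) =
      mat (Suc n) (Suc n) (\<lambda>(i, j). f (i, Suc j))"
    by (rule eq_matI) auto
  then have "g 0 + g (Suc n) =
    f (0, 0) * det (mat (Suc n) (Suc n) (\<lambda>(i, j). f (Suc i, Suc j))) +
    (-1) ^ Suc n * f (Suc n, 0) * det (mat (Suc n) (Suc n) (\<lambda>(i, j). f (i, Suc j)))"
    by (simp add: g_def)
  finally show ?thesis .
qed

lemma det_const_diag_lower_triangular:
  fixes f :: "nat \<times> nat \<Rightarrow> 'a::comm_ring_1"
  assumes "\<And>i j. i < j \<Longrightarrow> j < n \<Longrightarrow> f (i, j) = 0" and "\<And>i. i < n \<Longrightarrow> f (i, i) = a"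
  shows "det (mat n n f) = a ^ n"
proof -
  have "diag_mat (mat n n f) = map (\<lambda>_. a) [0..<n]"
    using assms(2) by (auto simp: diag_mat_def)
  then show ?thesis
    by (subst det_lower_triangular[of n]) (auto simp: assms(1) map_replicate_const)
qed

lemma det_const_diag_upper_triangular:
  fixes f :: "nat \<times> nat \<Rightarrow> 'a::comm_ring_1"
  assumes "\<And>i j. j < i \<Longrightarrow> i < n \<Longrightarrow> f (i, j) = 0" and "\<And>i. i < n \<Longrightarrow> f (i, i) = a"
  shows "det (mat n n f) = a ^ n"
proof -
  have "diag_mat (mat n n f) = map (\<lambda>_. a) [0..<n]"
    using assms(2) by (auto simp: diag_mat_def)
  then show ?thesis
    by (subst det_upper_triangular[of _ n]) (auto simp: assms(1) map_replicate_const)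
qed

section \<open>Tridiagonal matrices and their cyclic closure\<close>

text \<open>This is x I + a A with A the adjacency matrix of a path. For x = lambda and a = -1/2 it
  differs in general from lambda I minus the Randic matrix of a path, whose end vertices have degree
  1.\<close>

definition path_mat :: "'a::comm_ring_1 \<Rightarrow> 'a \<Rightarrow> nat \<Rightarrow> 'a mat" where
  "path_mat x a n = mat n n (\<lambda>(i, j).
    if i = j then x else if j = Suc i \<or> i = Suc j then a else 0)"

definition cycle_mat :: "'a::comm_ring_1 \<Rightarrow> 'a \<Rightarrow> nat \<Rightarrow> 'a mat" where
  "cycle_mat x a n = mat n n (\<lambda>(i, j).
    if i = j then x
    else if j = Suc i \<or> i = Suc j \<or> i = 0 \<and> Suc j = n \<or> j = 0 \<and> Suc i = n then a else 0)"

lemma det_path_mat_0: "det (path_mat x a 0) = 1"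
  by (simp add: path_mat_def)

lemma det_path_mat_1: "det (path_mat x a (Suc 0)) = x"
  unfolding path_mat_def by (subst det_expand_first_row) simp

text \<open>The first row has two nonzero entries, x and a; in the minor belonging to a, the first
  column is a followed by zeros, which yields the second factor a.\<close>

lemma det_path_mat_rec:
  "det (path_mat x a (Suc (Suc n))) =
    x * det (path_mat x a (Suc n)) - a\<^sup>2 * det (path_mat x a n)"
proof -
  define t where "t = (\<lambda>(i, j). if i = j then x else if j = Suc i \<or> i = Suc j then a else 0)"
  define g where "g j = (-1) ^ j * t (0, j) *
    det (mat (Suc n) (Suc n) (\<lambda>(i, k). t (Suc i, if k < j then k else Suc k)))" for j
  have pm: "path_mat x a k = mat k k t" for k
    by (simp add: path_mat_def t_def)
  \<comment> \<open>Entries are constant along diagonals, so removing the first row and column stays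
    within the family.\<close>
  have shift: "t (Suc i, Suc j) = t (i, j)" for i j
    by (simp add: t_def)
  have "det (path_mat x a (Suc (Suc n))) = sum g {..<Suc (Suc n)}"
    unfolding g_def pm by (rule det_expand_first_row)
  also have "\<dots> = sum g {0, 1}"
    by (rule sum.mono_neutral_right) (auto simp: g_def t_def)
  also have "\<dots> = x * det (path_mat x a (Suc n)) -
      a * det (mat (Suc n) (Suc n) (\<lambda>(i, k). t (Suc i, if k < 1 then k else Suc k)))"
    by (simp add: g_def shift pm) (simp add: t_def)
  also have "det (mat (Suc n) (Suc n) (\<lambda>(i, k). t (Suc i, if k < 1 then k else Suc k))) =
      a * det (path_mat x a n)"
  proof -
    define h where "h i = (-1) ^ i * t (Suc i, 0) *
      det (mat n n (\<lambda>(k, j). t (Suc (if k < i then k else Suc k), Suc (Suc j))))" for i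
    have "det (mat (Suc n) (Suc n) (\<lambda>(i, k). t (Suc i, if k < 1 then k else Suc k))) =
        sum h {..<Suc n}"
      unfolding h_def by (subst det_expand_first_column) simp
    also have "\<dots> = sum h {0}"
      by (rule sum.mono_neutral_right) (auto simp: h_def t_def)
    also have "\<dots> = a * det (path_mat x a n)"
      by (simp add: h_def shift pm) (simp add: t_def)
    finally show ?thesis .
  qed
  finally show ?thesis by (simp add: power2_eq_square mult.assoc)
qed

text \<open>Row 0 is nonzero exactly in columns 0, 1 and m + 2 for generic x and a. The last two
  columns contribute equally: each gives -a^2 times a path determinant, from a transposition of
  neighbours, and (-1)^m a^(m+3), from one of the two orientations of the full cycle.\<close>

lemma det_cycle_mat:
  "det (cycle_mat x a (m + 3)) =
    x * det (path_mat x a (m + 2)) - 2 * a\<^sup>2 * det (path_mat x a (m + 1)) +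
    2 * (-1) ^ m * a ^ (m + 3)"
proof -
  define c where "c = (\<lambda>(i, j). if i = j then x
    else if j = Suc i \<or> i = Suc j \<or> i = 0 \<and> j = m + 2 \<or> j = 0 \<and> i = m + 2 then a else 0)"
  define g where "g j = (-1) ^ j * c (0, j) *
    det (mat (m + 2) (m + 2) (\<lambda>(i, k). c (Suc i, if k < j then k else Suc k)))" for j
  define M1 where "M1 = mat (m + 2) (m + 2) (\<lambda>(i, k). c (Suc i, if k < 1 then k else Suc k))"
  define M2 where "M2 = mat (m + 2) (m + 2) (\<lambda>(i, k). c (Suc i, k))"
  have cm: "cycle_mat x a (m + 3) = mat (Suc (m + 2)) (Suc (m + 2)) c"
    by (rule eq_matI) (auto simp: cycle_mat_def c_def)
  \<comment> \<open>Both corner entries involve index 0, so the shift removes them and only the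
    tridiagonal band remains.\<close>
  have pm: "mat k k (\<lambda>(i, j). c (Suc i, Suc j)) = path_mat x a k" for k
    by (rule eq_matI) (auto simp: path_mat_def c_def)
  have pm': "mat k k (\<lambda>(i, j). c (Suc (Suc i), Suc (Suc j))) = path_mat x a k" for k
    by (rule eq_matI) (auto simp: path_mat_def c_def)
  have col0: "c (Suc i, 0) = 0" if "0 < i" "i < Suc m" for i
    using that by (simp add: c_def)
  have M1: "det M1 = a * det (path_mat x a (m + 1)) + (-1) ^ (m + 1) * a * a ^ (m + 1)"
  proof -
    \<comment> \<open>The extra column shift moves the superdiagonal of \<open>c\<close> onto the
      main diagonal, with the rest of the band below it.\<close>
    have "det (mat (Suc m) (Suc m) (\<lambda>(i, j). c (Suc i, Suc (Suc j)))) = a ^ (Suc m)"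
      by (rule det_const_diag_lower_triangular) (auto simp: c_def)
    moreover have "det (mat (Suc (Suc m)) (Suc (Suc m))
        (\<lambda>(i, k). c (Suc i, if k < 1 then k else Suc k))) =
      c (1, 0) * det (mat (Suc m) (Suc m) (\<lambda>(i, j). c (Suc (Suc i), Suc (Suc j)))) +
      (-1) ^ Suc m * c (Suc (Suc m), 0) *
        det (mat (Suc m) (Suc m) (\<lambda>(i, j). c (Suc i, Suc (Suc j))))"
      by (subst det_expand_first_column_ends) (auto simp: col0)
    moreover have "c (1, 0) = a" "c (Suc (Suc m), 0) = a"
      by (auto simp: c_def)
    ultimately show ?thesis by (simp add: M1_def pm' numeral_2_eq_2)
  qed
  have M2: "det M2 = a * a ^ (m + 1) + (-1) ^ (m + 1) * a * det (path_mat x a (m + 1))"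
  proof -
    \<comment> \<open>Dually, the subdiagonal becomes the main diagonal.\<close>
    have "det (mat (Suc m) (Suc m) (\<lambda>(i, j). c (Suc (Suc i), Suc j))) = a ^ (Suc m)"
      by (rule det_const_diag_upper_triangular) (auto simp: c_def)
    moreover have "det (mat (Suc (Suc m)) (Suc (Suc m)) (\<lambda>(i, k). c (Suc i, k))) =
      c (1, 0) * det (mat (Suc m) (Suc m) (\<lambda>(i, j). c (Suc (Suc i), Suc j))) +
      (-1) ^ Suc m * c (Suc (Suc m), 0) *
        det (mat (Suc m) (Suc m) (\<lambda>(i, j). c (Suc i, Suc j)))"
      by (subst det_expand_first_column_ends) (auto simp: col0)
    moreover have "c (1, 0) = a" "c (Suc (Suc m), 0) = a"
      by (auto simp: c_def)
    ultimately show ?thesis by (simp add: M2_def pm numeral_2_eq_2)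
  qed
  have M2': "mat (m + 2) (m + 2) (\<lambda>(i, k). c (Suc i, if k < m + 2 then k else Suc k)) = M2"
    unfolding M2_def by (rule eq_matI) auto
  have "det (cycle_mat x a (m + 3)) = sum g {..<Suc (m + 2)}"
    unfolding g_def cm by (rule det_expand_first_row)
  also have "\<dots> = sum g {0, 1, m + 2}"
    by (rule sum.mono_neutral_right) (auto simp: g_def c_def)
  also have "\<dots> = g 0 + g 1 + g (m + 2)"
    by simp
  also have "g 0 = x * det (path_mat x a (m + 2))"
    by (simp add: g_def pm) (simp add: c_def)
  also have "g 1 = - (a * det M1)"
    unfolding g_def M1_def by (simp add: c_def)
  also have "g (m + 2) = (-1) ^ m * a * det M2"
    unfolding g_def M2' by (simp add: c_def)
  also have "(-1) ^ m * a * det M2 = (-1) ^ m * a ^ (m + 3) - a\<^sup>2 * det (path_mat x a (m + 1))"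
  proof -
    \<comment> \<open>The sign of the corner position in row 0 cancels against the sign (-1)^(m+1)
      inside \<open>M2\<close> up to -1.\<close>
    have "(-1) ^ m * ((-1) ^ m * y) = y" for y :: 'a
      by (simp flip: mult.assoc power_mult_distrib)
    then show ?thesis
      by (simp add: M2 algebra_simps power2_eq_square numeral_3_eq_3)
  qed
  finally show ?thesis
    by (simp add: M1 algebra_simps power2_eq_square numeral_3_eq_3)
qed

text \<open>Since a^2 = 1/4 for a = -1/2, both sides satisfy the same recurrence. The value
  \<open>Lambda 0 = 1\<close> matches the empty determinant, which also enters the case of size
  2.\<close>

lemma det_path_mat_eq_Lambda: "det (path_mat [:0, 1:] [:-1/2:] n) = Lambda n"
proof (induction n rule: Lambda.induct)
  case 1
  show ?case by (simp add: det_path_mat_0)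
next
  case 2
  show ?case by (simp add: det_path_mat_1)
next
  case 3
  show ?case
    by (simp add: det_path_mat_rec det_path_mat_0 det_path_mat_1 power2_eq_square)
next
  case (4 k)
  then show ?case
    \<comment> \<open>Fixing the index unfolds the recurrence only once, leaving the two smaller
      determinants to the induction hypotheses.\<close>
    by (simp add: det_path_mat_rec[of _ _ "Suc k"] power2_eq_square)
qed

section \<open>The Randic matrix of the cycle\<close>

text \<open>Resolving the wrap-around of \<open>mod\<close> puts adjacency in the form of the case
  distinction in \<open>cycle_mat\<close>.\<close>

lemma cycle_graph_arc_iff:
  assumes "n \<ge> 3" "i < n" "j < n"
  shows "(i, j) \<in> parcs (cycle_graph n) \<longleftrightarrow>
    j = Suc i \<or> i = Suc j \<or> i = 0 \<and> Suc j = n \<or> j = 0 \<and> Suc i = n"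
  using assms by (auto simp: cycle_graph_def mod_Suc)

lemma out_degree_cycle_graph:
  assumes "n \<ge> 3" "i < n"
  shows "out_degree (with_proj (cycle_graph n)) i = 2"
proof -
  define p where "p = (if i = 0 then n - 1 else i - 1)"
  define s where "s = (if Suc i = n then 0 else Suc i)"
  have "out_arcs (with_proj (cycle_graph n)) i = {(i, p), (i, s)}"
    using assms by (auto simp: out_arcs_def cycle_graph_def mod_Suc p_def s_def split: if_splits)
  \<comment> \<open>The cyclic predecessor and successor differ because the cycle has at least three
    vertices.\<close>
  moreover have "p \<noteq> s"
    using assms by (auto simp: p_def s_def)
  ultimately show ?thesis
    by (simp add: out_degree_def)
qed

text \<open>All degrees are 2, so every arc has weight 1 / sqrt (2 * 2) = 1/2; the diagonal is
  lambda because there are no loops.\<close>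

lemma char_poly_matrix_cycle_graph:
  assumes "n \<ge> 3"
  shows "char_poly_matrix (randic_matrix (cycle_graph n)) = cycle_mat [:0, 1:] [:-1/2:] n"
proof (rule eq_matI)
  have vs: "sorted_list_of_set (pverts (cycle_graph n)) = [0..<n]"
    by (simp add: cycle_graph_def)
  show "dim_row (char_poly_matrix (randic_matrix (cycle_graph n))) =
      dim_row (cycle_mat [:0, 1:] [:-1/2:] n)"
    "dim_col (char_poly_matrix (randic_matrix (cycle_graph n))) =
      dim_col (cycle_mat [:0, 1:] [:-1/2:] n)"
    by (simp_all add: char_poly_matrix_def randic_matrix_def Let_def vs cycle_mat_def)
  fix i j
  assume "i < dim_row (cycle_mat [:0, 1:] [:-1/2:] n)" "j < dim_col (cycle_mat [:0, 1:] [:-1/2:] n)"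
  then have ij: "i < n" "j < n"
    by (simp_all add: cycle_mat_def)
  show "char_poly_matrix (randic_matrix (cycle_graph n)) $$ (i, j) =
      cycle_mat [:0, 1:] [:-1/2:] n $$ (i, j)"
    using ij assms
    by (auto simp: char_poly_matrix_def randic_matrix_def Let_def vs cycle_mat_def
        cycle_graph_arc_iff out_degree_cycle_graph)
qed

theorem theorem2:
  fixes n :: nat
  assumes "n \<ge> 3"
  shows "randic_char_poly (cycle_graph n) =
    [:0, 1:] * Lambda (n - 1) - [:1/2:] * Lambda (n - 2) - [:(1/2) ^ (n - 1):]"
proof -
  obtain m where n: "n = m + 3"
    using assms le_Suc_ex by (metis add.commute)
  \<comment> \<open>This is the coefficient 2 a^2 of the smaller path determinant in
    \<open>det_cycle_mat\<close>.\<close>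
  have sq: "2 * [:-1/2::real:]\<^sup>2 = [:1/2:]"
    by (simp add: power2_eq_square numeral_poly)
  have "[:-1/2::real:] ^ k = [:(-1/2) ^ k:]" for k
    by (induction k) (simp_all add: one_pCons)
  moreover have "(-1 :: real poly) ^ k = [:(-1) ^ k:]" for k
    by (induction k) (simp_all add: one_pCons)
  \<comment> \<open>The two signs combine to (-1)^(2m+3) = -1, and the factor 2 lowers the exponent
    from m + 3 = n to m + 2 = n - 1.\<close>
  moreover have "2 * ((-1) ^ m * (-1/2) ^ (m + 3)) = - ((1/2::real) ^ (m + 2))"
  proof -
    have "(-1) ^ m * (-1/2) ^ m = (1/2::real) ^ m"
      by (simp flip: power_mult_distrib)
    then show ?thesis by (simp add: power_add power3_eq_cube power2_eq_square)
  qed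
  ultimately have const: "2 * (-1) ^ m * [:-1/2::real:] ^ (m + 3) = - [:(1/2) ^ (m + 2):]"
    by (simp add: numeral_poly mult_ac)
  have "randic_char_poly (cycle_graph n) = det (cycle_mat [:0, 1:] [:-1/2:] (m + 3))"
    by (simp add: randic_char_poly_def char_poly_def char_poly_matrix_cycle_graph n)
  also have "\<dots> = [:0, 1:] * Lambda (m + 2) - [:1/2:] * Lambda (m + 1) - [:(1/2) ^ (m + 2):]"
    unfolding det_cycle_mat det_path_mat_eq_Lambda sq const by simp
  finally show ?thesis
    by (simp add: n)
qed

end
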